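(* Let $(X,\mathcal E)$ be a locally finite connected graph with symmetric edge weights $\mu_{xy}=\mu_{yx}>0$. Assume that $u, Q: X\to\mathbb R$ are functions with $u\ge 0$ on $X$ and $-\Delta u+Qu=0$ on $X$. Then $$|\nabla u|^2(x)\le P(x)\,u^2(x)\qquad\text{for all } x\in X,$$ where $P(x)=\hat d_x\,(1+Q(x))^2-2Q(x)-1$ and $\hat d_x=\sup_{y:(x,y)\in\mathcal E}\frac{d_x}{\mu_{xy}}$.
   Context: A locally finite connected graph $(X,\mathcal E)$ is a simple (no loops, no multiple edges), connected graph with countable vertex set $X$ and edge set $\mathcal E$ in which each vertex has finitely many neighbors. It carries a symmetric weight $\mu_{xy}=\mu_{yx}>0$ on $\mathcal E$, and $d_x=\sum_{y:(x,y)\in\mathcal E}\mu_{xy}<\infty$ is the degree of $x$. For $u:X\to\mathbb R$, the Laplacian is $(\Delta u)(x)=\sum_{y:(x,y)\in\mathcal E}\frac{\mu_{xy}}{d_x}(u(y)-u(x))$ and $|\nabla u|^2(x)=\sum_{y:(x,y)\in\mathcal E}\frac{\mu_{xy}}{d_x}(u(y)-u(x))^2$. *)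

theory Defs
  imports "HOL-Analysis.Analysis"
begin

(* A simple undirected graph is encoded by a symmetric irreflexive relation E on the vertex
   set X; the neighbours of x are E `` {x}. *)

locale locally_finite_connected_graph =
  fixes X :: "'a set" and E :: "('a \<times> 'a) set"
  assumes countable_vertices: "countable X"
    and edges_subset: "E \<subseteq> X \<times> X"
    and edges_sym: "sym E"
    and no_loops: "irrefl E"
    and connected_graph: "\<And>x y. x \<in> X \<Longrightarrow> y \<in> X \<Longrightarrow> (x, y) \<in> E\<^sup>*"
    and locally_finite: "\<And>x. x \<in> X \<Longrightarrow> finite (E `` {x})"

(* The values of \<mu> off the edge set are irrelevant and left unconstrained. *)

locale weighted_locally_finite_connected_graph = locally_finite_connected_graph X E
  for X :: "'a set" and E :: "('a \<times> 'a) set" +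
  fixes \<mu> :: "'a \<Rightarrow> 'a \<Rightarrow> real"
  assumes weight_sym: "\<And>x y. (x, y) \<in> E \<Longrightarrow> \<mu> x y = \<mu> y x"
    and weight_pos: "\<And>x y. (x, y) \<in> E \<Longrightarrow> 0 < \<mu> x y"

definition wdegree :: "('a \<times> 'a) set \<Rightarrow> ('a \<Rightarrow> 'a \<Rightarrow> real) \<Rightarrow> 'a \<Rightarrow> real" where
  "wdegree E \<mu> x = (\<Sum>y\<in>E `` {x}. \<mu> x y)"

definition laplacian ::
    "('a \<times> 'a) set \<Rightarrow> ('a \<Rightarrow> 'a \<Rightarrow> real) \<Rightarrow> ('a \<Rightarrow> real) \<Rightarrow> 'a \<Rightarrow> real" where
  "laplacian E \<mu> u x = (\<Sum>y\<in>E `` {x}. \<mu> x y / wdegree E \<mu> x * (u y - u x))"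

definition grad_sq ::
    "('a \<times> 'a) set \<Rightarrow> ('a \<Rightarrow> 'a \<Rightarrow> real) \<Rightarrow> ('a \<Rightarrow> real) \<Rightarrow> 'a \<Rightarrow> real" where
  "grad_sq E \<mu> u x = (\<Sum>y\<in>E `` {x}. \<mu> x y / wdegree E \<mu> x * (u y - u x)\<^sup>2)"

(* Meaningful only if x has a neighbour: the supremum of the empty set of reals is unspecified. *)
definition dhat :: "('a \<times> 'a) set \<Rightarrow> ('a \<Rightarrow> 'a \<Rightarrow> real) \<Rightarrow> 'a \<Rightarrow> real" where
  "dhat E \<mu> x = (SUP y\<in>E `` {x}. wdegree E \<mu> x / \<mu> x y)"

definition grad_bound ::
    "('a \<times> 'a) set \<Rightarrow> ('a \<Rightarrow> 'a \<Rightarrow> real) \<Rightarrow> ('a \<Rightarrow> real) \<Rightarrow> 'a \<Rightarrow> real" where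
  "grad_bound E \<mu> Q x = dhat E \<mu> x * (1 + Q x)\<^sup>2 - 2 * Q x - 1"

end

theory Submission
  imports Defs
begin

text \<open>
  The edge weights at a vertex \<open>x\<close> induce a probability vector \<open>p y = \<mu> x y / d x\<close> on its
  neighbours, and the equation says that the \<open>p\<close>-mean of \<open>u\<close> is \<open>(1 + Q x) * u x\<close>. Expanding
  the square leaves the second moment of \<open>u\<close>. Since \<open>1 \<le> dhat x * p y\<close> and the terms
  \<open>p y * u y\<close> are nonnegative, the second moment is at most \<open>dhat x\<close> times the sum of the
  \<open>(p y * u y)\<^sup>2\<close>, hence at most \<open>dhat x\<close> times the square of the mean.
\<close>

lemma sum_squares_le_square_sum:
  fixes f :: "'a \<Rightarrow> 'b::linordered_idom"
  assumes "finite A" "\<And>y. y \<in> A \<Longrightarrow> 0 \<le> f y"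
  shows "(\<Sum>y\<in>A. (f y)\<^sup>2) \<le> (\<Sum>y\<in>A. f y)\<^sup>2"
  using assms
proof (induction A rule: finite_induct)
  case (insert a A)
  \<comment> \<open>This is half the cross term of \<open>(f a + sum f A)\<^sup>2\<close>, so
    dropping it only decreases the square.\<close>
  have "0 \<le> f a * sum f A"
    using insert.prems by (simp add: sum_nonneg)
  moreover have "(\<Sum>y\<in>A. (f y)\<^sup>2) \<le> (sum f A)\<^sup>2"
    using insert by simp
  ultimately show ?case
    using insert.hyps by (simp add: power2_sum)
qed simp

lemma second_moment_le:
  fixes p v :: "'a \<Rightarrow> real"
  assumes "finite A" "0 \<le> D"
    and p: "\<And>y. y \<in> A \<Longrightarrow> 0 \<le> p y" and D: "\<And>y. y \<in> A \<Longrightarrow> 1 \<le> D * p y"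
    and v: "\<And>y. y \<in> A \<Longrightarrow> 0 \<le> v y"
  shows "(\<Sum>y\<in>A. p y * (v y)\<^sup>2) \<le> D * (\<Sum>y\<in>A. p y * v y)\<^sup>2"
proof -
  have "(\<Sum>y\<in>A. p y * (v y)\<^sup>2) \<le> (\<Sum>y\<in>A. D * (p y * v y)\<^sup>2)"
  proof (rule sum_mono)
    fix y assume y: "y \<in> A"
    \<comment> \<open>The factor \<open>D * p y\<close> supplies the second \<open>p y\<close> that
      turns the weighted square into \<open>(p y * v y)\<^sup>2\<close>.\<close>
    have "1 * (p y * (v y)\<^sup>2) \<le> (D * p y) * (p y * (v y)\<^sup>2)"
      using D[OF y] p[OF y] by (intro mult_right_mono) auto
    then show "p y * (v y)\<^sup>2 \<le> D * (p y * v y)\<^sup>2"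
      by (simp add: power2_eq_square mult_ac)
  qed
  also have "\<dots> = D * (\<Sum>y\<in>A. (p y * v y)\<^sup>2)"
    by (simp add: sum_distrib_left)
  also have "\<dots> \<le> D * (\<Sum>y\<in>A. p y * v y)\<^sup>2"
    using assms by (intro mult_left_mono sum_squares_le_square_sum) auto
  finally show ?thesis .
qed

context weighted_locally_finite_connected_graph
begin

text \<open>A path from \<open>x\<close> to a different vertex has a first edge, which leaves
  \<open>x\<close>.\<close>

lemma neighbours_nonempty:
  assumes "x \<in> X" "\<not> is_singleton X"
  shows "E `` {x} \<noteq> {}"
proof -
  obtain y where "y \<in> X" "y \<noteq> x"
    using assms by (metis is_singletonI' empty_iff)
  then show ?thesis
    using connected_graph[OF \<open>x \<in> X\<close> \<open>y \<in> X\<close>] by (auto elim: converse_rtranclE)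
qed

lemma wdegree_pos:
  assumes "x \<in> X" "E `` {x} \<noteq> {}"
  shows "0 < wdegree E \<mu> x"
  unfolding wdegree_def using assms locally_finite weight_pos by (intro sum_pos) auto

text \<open>Local finiteness bounds the set of ratios, so the real supremum is a genuine upper
  bound.\<close>

lemma wdegree_div_weight_le_dhat:
  assumes "x \<in> X" "(x, y) \<in> E"
  shows "wdegree E \<mu> x / \<mu> x y \<le> dhat E \<mu> x"
  unfolding dhat_def using assms locally_finite
  by (intro cSUP_upper bdd_above_finite finite_imageI) auto

lemma sum_transition:
  assumes "x \<in> X" "E `` {x} \<noteq> {}"
  shows "(\<Sum>y\<in>E `` {x}. \<mu> x y / wdegree E \<mu> x) = 1"
  using wdegree_pos[OF assms] by (simp add: wdegree_def flip: sum_divide_distrib)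

lemma mean_eq_laplacian:
  assumes "x \<in> X" "E `` {x} \<noteq> {}"
  shows "(\<Sum>y\<in>E `` {x}. \<mu> x y / wdegree E \<mu> x * u y) = u x + laplacian E \<mu> u x"
  unfolding laplacian_def right_diff_distrib sum_subtractf sum_distrib_right[symmetric]
    sum_transition[OF assms] by simp

text \<open>Total mass 1 turns the constant term into \<open>(u x)\<^sup>2\<close>, and the
  Laplacian replaces the mean in the cross term.\<close>

lemma grad_sq_eq:
  assumes "x \<in> X" "E `` {x} \<noteq> {}"
  shows "grad_sq E \<mu> u x =
    (\<Sum>y\<in>E `` {x}. \<mu> x y / wdegree E \<mu> x * (u y)\<^sup>2) - (u x)\<^sup>2 - 2 * u x * laplacian E \<mu> u x"
proof -
  let ?p = "\<lambda>y. \<mu> x y / wdegree E \<mu> x"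
  have "grad_sq E \<mu> u x =
      (\<Sum>y\<in>E `` {x}. ?p y * (u y)\<^sup>2 - 2 * u x * (?p y * u y) + ?p y * (u x)\<^sup>2)"
    unfolding grad_sq_def
    by (intro sum.cong refl) (simp only: power2_diff, simp add: algebra_simps)
  also have "\<dots> = (\<Sum>y\<in>E `` {x}. ?p y * (u y)\<^sup>2)
      - 2 * u x * (\<Sum>y\<in>E `` {x}. ?p y * u y) + (\<Sum>y\<in>E `` {x}. ?p y) * (u x)\<^sup>2"
    by (simp only: sum.distrib sum_subtractf sum_distrib_left sum_distrib_right)
  finally show ?thesis
    using sum_transition[OF assms] mean_eq_laplacian[OF assms, of u]
    by (simp add: algebra_simps power2_eq_square)
qed

end

text \<open>In a one-vertex graph \<open>dhat\<close> would be the supremum of an empty set, hence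
  the exclusion of singletons.\<close>

theorem theorem2p3:
  fixes X :: "'a set" and E :: "('a \<times> 'a) set"
    and \<mu> :: "'a \<Rightarrow> 'a \<Rightarrow> real" and u Q :: "'a \<Rightarrow> real"
  assumes "weighted_locally_finite_connected_graph X E \<mu>"
    and "\<not> is_singleton X"
    and "\<forall>x\<in>X. 0 \<le> u x"
    and "\<forall>x\<in>X. - laplacian E \<mu> u x + Q x * u x = 0"
  shows "\<forall>x\<in>X. grad_sq E \<mu> u x \<le> grad_bound E \<mu> Q x * (u x)\<^sup>2"
proof
  interpret weighted_locally_finite_connected_graph X E \<mu> by fact
  fix x assume x: "x \<in> X"
  let ?p = "\<lambda>y. \<mu> x y / wdegree E \<mu> x"
  have ne: "E `` {x} \<noteq> {}"
    using neighbours_nonempty x assms(2) .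
  have d: "0 < wdegree E \<mu> x"
    using wdegree_pos x ne .
  have L: "laplacian E \<mu> u x = Q x * u x"
    using assms(4) x by fastforce
  have D: "1 \<le> dhat E \<mu> x * ?p y" if "(x, y) \<in> E" for y
    using wdegree_div_weight_le_dhat[OF x that] weight_pos[OF that] d
    by (simp add: field_simps)
  have "0 \<le> dhat E \<mu> x"
  proof -
    obtain y where y: "(x, y) \<in> E"
      using ne by blast
    have "0 \<le> wdegree E \<mu> x / \<mu> x y"
      using d weight_pos[OF y] by simp
    also have "\<dots> \<le> dhat E \<mu> x"
      using wdegree_div_weight_le_dhat[OF x y] .
    finally show ?thesis .
  qed
  \<comment> \<open>Neighbours of \<open>x\<close> lie in \<open>X\<close> by
    \<open>edges_subset\<close>, so \<open>u\<close> is nonnegative there.\<close>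
  then have "(\<Sum>y\<in>E `` {x}. ?p y * (u y)\<^sup>2) \<le> dhat E \<mu> x * (\<Sum>y\<in>E `` {x}. ?p y * u y)\<^sup>2"
    using locally_finite[OF x] D d weight_pos edges_subset assms(3)
    by (intro second_moment_le) (auto intro: divide_nonneg_pos less_imp_le)
  also have "\<dots> = dhat E \<mu> x * ((1 + Q x) * u x)\<^sup>2"
    unfolding mean_eq_laplacian[OF x ne] L by (simp add: distrib_right)
  finally show "grad_sq E \<mu> u x \<le> grad_bound E \<mu> Q x * (u x)\<^sup>2"
    unfolding grad_sq_eq[OF x ne] grad_bound_def L
    by (simp add: algebra_simps power2_eq_square)
qed

end
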